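(* Let $B$ be an abelian group (written additively) with operators in a nonempty set $A$. Let $\sigma_A,\delta_A\colon A\to A$ be maps and let $\sigma_B,\delta_B\colon B\to B$ be additive maps. Suppose that $\delta_B$ is a $\delta_A$-twisted $\sigma_A$-derivation and that $\sigma_B$ is $\sigma_A$-twisted. Take $a\in A$, $b\in B$ and $i,m\in\mathbb{N}$. Then $$\pi_i^m(ab)=\sum_{k\in\mathbb{N}}\pi_k^m(a)\,\pi_i^k(b).$$
   Context: $\mathbb{N}=\{0,1,2,\ldots\}$. $B$ is an abelian group with operators in $A$ if each $a\in A$ acts on $B$ (written $b\mapsto ab$) as a group endomorphism: $a(b+c)=ab+ac$. It is assumed that $A$ contains a fixed zero element, i.e. an element $0\in A$ with $0b=0$ for all $b\in B$. $\sigma_B$ is $\sigma_A$-twisted if $\sigma_B(ab)=\sigma_A(a)\sigma_B(b)$ for all $a\in A$, $b\in B$. $\delta_B$ is a $\delta_A$-twisted $\sigma_A$-derivation if $\delta_B(ab)=\sigma_A(a)\delta_B(b)+\delta_A(a)b$ for all $a\in A$, $b\in B$. For $i\ge j$ in $\mathbb{N}$, $\pi_j^i\colon B\to B$ is the sum of all $\binom{i}{j}$ compositions of $j$ instances of $\sigma_B$ and $i-j$ instances of $\delta_B$; if $i<j$, then $\pi_j^i=0$. The same symbol applied to an element $a\in A$ is the same expression with $\sigma_A,\delta_A$ in place of $\sigma_B,\delta_B$: $\pi_k^m(a)$ is the sum of all $\binom{m}{k}$ compositions of $k$ instances of $\sigma_A$ and $m-k$ instances of $\delta_A$, evaluated at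 $a$ (and $0$ if $m<k$). In the product $\pi_k^m(a)\,\pi_i^k(b)$, the element $\pi_k^m(a)$ acts as an operator on $\pi_i^k(b)\in B$. *)

theory Defs
  imports
    "HOL.Modules"
    "HOL-Library.FuncSet"
    "HOL-Library.Groups_Big_Fun"
    "HOL-Library.Multiset"
begin

definition group_with_operators ::
    "'a set \<Rightarrow> 'a \<Rightarrow> ('a \<Rightarrow> 'b \<Rightarrow> 'b::ab_group_add) \<Rightarrow> bool" where
  "group_with_operators A z act \<longleftrightarrow>
     z \<in> A \<and> (\<forall>a\<in>A. additive (act a)) \<and> (\<forall>b. act z b = 0)"

definition twisted ::
    "'a set \<Rightarrow> ('a \<Rightarrow> 'b \<Rightarrow> 'b) \<Rightarrow> ('a \<Rightarrow> 'a) \<Rightarrow> ('b \<Rightarrow> 'b::ab_group_add) \<Rightarrow> bool" where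
  "twisted A act \<sigma>\<^sub>A \<sigma>\<^sub>B \<longleftrightarrow>
     (\<forall>a\<in>A. \<forall>b. \<sigma>\<^sub>B (act a b) = act (\<sigma>\<^sub>A a) (\<sigma>\<^sub>B b))"

definition twisted_derivation ::
    "'a set \<Rightarrow> ('a \<Rightarrow> 'b \<Rightarrow> 'b) \<Rightarrow> ('a \<Rightarrow> 'a) \<Rightarrow> ('a \<Rightarrow> 'a) \<Rightarrow> ('b \<Rightarrow> 'b::ab_group_add) \<Rightarrow> bool" where
  "twisted_derivation A act \<sigma>\<^sub>A \<delta>\<^sub>A \<delta>\<^sub>B \<longleftrightarrow>
     (\<forall>a\<in>A. \<forall>b. \<delta>\<^sub>B (act a b) = act (\<sigma>\<^sub>A a) (\<delta>\<^sub>B b) + act (\<delta>\<^sub>A a) b)"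

text \<open>
  The compositions of \<open>k\<close> instances of \<open>\<sigma>\<close> and \<open>m - k\<close> instances of \<open>\<delta>\<close> are indexed by
  the words of length \<open>m\<close> with \<open>k\<close> letters \<open>True\<close> (standing for \<open>\<sigma>\<close>). Sums run over words
  and not over the resulting maps, since different words may give the same map.
\<close>

definition words :: "nat \<Rightarrow> nat \<Rightarrow> bool list set" where
  "words m k = {w. length w = m \<and> count_list w True = k}"

definition composite :: "('c \<Rightarrow> 'c) \<Rightarrow> ('c \<Rightarrow> 'c) \<Rightarrow> bool list \<Rightarrow> 'c \<Rightarrow> 'c" where
  "composite \<sigma> \<delta> w = foldr (\<lambda>is_sigma. if is_sigma then \<sigma> else \<delta>) w"

text \<open>
  \<open>pi_map \<sigma> \<delta> m k\<close> is the map \<open>\<pi>\<^sub>k\<^sup>m\<close>: the upper index comes first. For \<open>m < k\<close> there are no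
  words, so the sum is \<open>0\<close>.
\<close>

definition pi_map ::
    "('c \<Rightarrow> 'c) \<Rightarrow> ('c \<Rightarrow> 'c) \<Rightarrow> nat \<Rightarrow> nat \<Rightarrow> 'c \<Rightarrow> 'c::comm_monoid_add" where
  "pi_map \<sigma> \<delta> m k c = (\<Sum>w\<in>words m k. composite \<sigma> \<delta> w c)"

text \<open>
  The operator set has no addition, so \<open>\<pi>\<^sub>k\<^sup>m(a)\<close> for an operator \<open>a\<close> is a formal sum of
  operators, i.e. a finite multiset, which acts on \<open>B\<close> as the sum of the actions of its
  members. For \<open>m < k\<close> it is the zero operator \<open>z\<close>. When the operators do carry an addition
  on which the action is additive, this agrees with computing the sum among the operators
  (\<open>act_sum_pi_op_eq\<close> below).
\<close>

definition pi_op ::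
    "'a \<Rightarrow> ('a \<Rightarrow> 'a) \<Rightarrow> ('a \<Rightarrow> 'a) \<Rightarrow> nat \<Rightarrow> nat \<Rightarrow> 'a \<Rightarrow> 'a multiset" where
  "pi_op z \<sigma> \<delta> m k a =
     (if m < k then {#z#} else image_mset (\<lambda>w. composite \<sigma> \<delta> w a) (mset_set (words m k)))"

definition act_sum :: "('a \<Rightarrow> 'b \<Rightarrow> 'b) \<Rightarrow> 'a multiset \<Rightarrow> 'b \<Rightarrow> 'b::ab_group_add" where
  "act_sum act M b = (\<Sum>a\<in>#M. act a b)"

lemma finite_words [simp]: "finite (words m k)"
  by (rule finite_subset[OF _ finite_lists_length_eq[of "UNIV :: bool set" m]])
     (auto simp: words_def)

lemma words_eq_empty: "m < k \<Longrightarrow> words m k = {}"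
  unfolding words_def using count_le_length[of _ True] by (auto simp: not_le[symmetric])

lemma words_0: "words 0 k = (if k = 0 then {[]} else {})"
  by (auto simp: words_def)

lemma words_Suc_0: "words (Suc m) 0 = (#) False ` words m 0"
  by (auto simp: words_def length_Suc_conv image_iff split: if_splits)

lemma words_Suc_Suc: "words (Suc m) (Suc k) = (#) True ` words m k \<union> (#) False ` words m (Suc k)"
  by (auto simp: words_def length_Suc_conv image_iff split: if_splits)

lemma card_words: "card (words m k) = m choose k"
proof (induction m arbitrary: k)
  case 0
  show ?case by (cases k) (auto simp: words_0)
next
  case (Suc m)
  show ?case
  proof (cases k)
    case 0
    then show ?thesis using Suc by (simp add: words_Suc_0 card_image)
  next
    case (Suc k')
    have "((#) True ` words m k') \<inter> ((#) False ` words m (Suc k')) = {}" by auto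
    then show ?thesis using Suc Suc.IH
      by (simp add: words_Suc_Suc card_Un_disjoint card_image)
  qed
qed

lemma act_sum_pi_op_eq_0:
  "group_with_operators A z act \<Longrightarrow> m < k \<Longrightarrow> act_sum act (pi_op z \<sigma> \<delta> m k a) b = 0"
  by (simp add: act_sum_def pi_op_def group_with_operators_def)

text \<open>
  Hence a sum over all \<open>k\<close> of terms of this kind has finite support, so that \<^const>\<open>Sum_any\<close>
  does not take its default value.
\<close>

lemma finite_support_act_sum_pi_op:
  assumes "group_with_operators A z act"
  shows "finite {k. act_sum act (pi_op z \<sigma> \<delta> m k a) (f k) \<noteq> 0}"
proof (rule finite_subset)
  show "{k. act_sum act (pi_op z \<sigma> \<delta> m k a) (f k) \<noteq> 0} \<subseteq> {..m}"
    using act_sum_pi_op_eq_0[OF assms] by (auto simp: not_less[symmetric])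
qed simp

lemma act_sum_pi_op_eq:
  fixes act :: "'a::comm_monoid_add \<Rightarrow> 'b \<Rightarrow> 'b::ab_group_add"
  assumes add: "\<And>a a' b. act (a + a') b = act a b + act a' b"
    and zero: "\<And>b. act 0 b = 0"
  shows "act_sum act (pi_op 0 \<sigma> \<delta> m k a) b = act (pi_map \<sigma> \<delta> m k a) b"
proof -
  have "act (sum g W) b = (\<Sum>w\<in>W. act (g w) b)" if "finite W" for g :: "bool list \<Rightarrow> 'a" and W
    using that by induction (simp_all add: add zero)
  then show ?thesis
    by (simp add: act_sum_def pi_op_def pi_map_def zero words_eq_empty
        sum_unfold_sum_mset image_mset.compositionality comp_def)
qed

end

theory Submission
  imports Defs
begin

text \<open>
  Grouping the right-hand side by words, it is the sum over all words \<open>w\<close> of length \<open>m\<close> of the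
  terms \<open>act (w(a)) (\<pi>\<^sub>i\<^sup>k(b))\<close>, where \<open>k\<close> is the number of letters \<open>\<sigma>\<close> in \<open>w\<close>. In this form the
  identity follows by induction on \<open>m\<close>, splitting off the outermost letter: applying
  \<open>\<pi>\<^sub>i\<^sup>m\<^sup>+\<^sup>1 = \<sigma> \<pi>\<^sub>i\<^sub>-\<^sub>1\<^sup>m + \<delta> \<pi>\<^sub>i\<^sup>m\<close> and the twisting rules to a term with operator \<open>c = w(a)\<close> gives
  \<open>act (\<sigma> c) (\<sigma> \<pi>\<^sub>i\<^sub>-\<^sub>1\<^sup>k b + \<delta> \<pi>\<^sub>i\<^sup>k b) + act (\<delta> c) (\<pi>\<^sub>i\<^sup>k b)\<close>, which are the terms of the words
  \<open>\<sigma> w\<close> and \<open>\<delta> w\<close> (with \<open>\<pi>\<^sub>-\<^sub>1 = 0\<close>).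
\<close>

lemma composite_simps [simp]:
  "composite \<sigma> \<delta> [] c = c"
  "composite \<sigma> \<delta> (True # w) c = \<sigma> (composite \<sigma> \<delta> w c)"
  "composite \<sigma> \<delta> (False # w) c = \<delta> (composite \<sigma> \<delta> w c)"
  by (simp_all add: composite_def)

lemma composite_closed:
  "\<sigma> \<in> A \<rightarrow> A \<Longrightarrow> \<delta> \<in> A \<rightarrow> A \<Longrightarrow> c \<in> A \<Longrightarrow> composite \<sigma> \<delta> w c \<in> A"
  by (induction w) (auto simp: composite_def)

lemma pi_map_0: "pi_map \<sigma> \<delta> 0 i c = (if i = 0 then c else 0)"
  by (simp add: pi_map_def words_0)

text \<open>Classify words by their first letter, which \<open>foldr\<close> applies outermost;
  additivity pulls that map out of the sum. The case \<open>i = 0\<close> is separate because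
  \<open>i - 1\<close> truncates to \<open>0\<close>.\<close>

lemma pi_map_Suc:
  fixes \<sigma> \<delta> :: "'b \<Rightarrow> 'b::ab_group_add"
  assumes "additive \<sigma>" "additive \<delta>"
  shows "pi_map \<sigma> \<delta> (Suc m) i c =
    (if i = 0 then 0 else \<sigma> (pi_map \<sigma> \<delta> m (i - 1) c)) + \<delta> (pi_map \<sigma> \<delta> m i c)"
proof (cases i)
  case 0
  then show ?thesis
    by (simp add: pi_map_def words_Suc_0 sum.reindex additive.sum[OF assms(2)])
next
  case (Suc j)
  have "((#) True ` words m j) \<inter> ((#) False ` words m (Suc j)) = {}" by auto
  then show ?thesis using Suc
    by (simp add: pi_map_def words_Suc_Suc sum.union_disjoint sum.reindex
        additive.sum[OF assms(1)] additive.sum[OF assms(2)])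
qed

lemma finite_lists_length [simp]: "finite {w :: bool list. length w = m}"
  using finite_lists_length_eq[of "UNIV :: bool set" m] by simp

lemma sum_lists_length_Suc:
  fixes g :: "bool list \<Rightarrow> 'b::comm_monoid_add"
  shows "(\<Sum>w | length w = Suc m. g w) = (\<Sum>w | length w = m. g (True # w) + g (False # w))"
proof -
  let ?L = "{w :: bool list. length w = m}"
  have "{w. length w = Suc m} = (#) True ` ?L \<union> (#) False ` ?L"
    by (auto simp: length_Suc_conv)
  moreover have "((#) True ` ?L) \<inter> ((#) False ` ?L) = {}" by auto
  ultimately show ?thesis
    by (simp add: sum.union_disjoint sum.reindex sum.distrib)
qed

lemma pi_map_act_eq_sum_words:
  assumes ops: "group_with_operators A z act"
    and maps: "\<sigma>\<^sub>A \<in> A \<rightarrow> A" "\<delta>\<^sub>A \<in> A \<rightarrow> A"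
    and add: "additive \<sigma>\<^sub>B" "additive \<delta>\<^sub>B"
    and der: "twisted_derivation A act \<sigma>\<^sub>A \<delta>\<^sub>A \<delta>\<^sub>B"
    and tw: "twisted A act \<sigma>\<^sub>A \<sigma>\<^sub>B"
    and a: "a \<in> A"
  shows "pi_map \<sigma>\<^sub>B \<delta>\<^sub>B m i (act a b) =
    (\<Sum>w | length w = m. act (composite \<sigma>\<^sub>A \<delta>\<^sub>A w a) (pi_map \<sigma>\<^sub>B \<delta>\<^sub>B (count_list w True) i b))"
proof (induction m arbitrary: i)
  case 0
  \<comment> \<open>For \<open>i > 0\<close> the empty word contributes
    \<open>act a 0\<close>.\<close>
  have "act a 0 = 0"
    using ops a by (auto simp: group_with_operators_def intro: additive.zero)
  then show ?case by (simp add: pi_map_0)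
next
  case (Suc m)
  let ?c = "\<lambda>w. composite \<sigma>\<^sub>A \<delta>\<^sub>A w a"
  let ?p = "\<lambda>w i. pi_map \<sigma>\<^sub>B \<delta>\<^sub>B (count_list w True) i b"
  have c: "?c w \<in> A" for w
    by (rule composite_closed[OF maps a])
  have act: "additive (act (\<sigma>\<^sub>A (?c w)))" for w
    using ops maps c by (auto simp: group_with_operators_def)
  have sig: "\<sigma>\<^sub>B (act (?c w) x) = act (\<sigma>\<^sub>A (?c w)) (\<sigma>\<^sub>B x)" for w x
    using tw c by (simp add: twisted_def)
  have del: "\<delta>\<^sub>B (act (?c w) x) = act (\<sigma>\<^sub>A (?c w)) (\<delta>\<^sub>B x) + act (\<delta>\<^sub>A (?c w)) x" for w x
    using der c by (simp add: twisted_derivation_def)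
  have "pi_map \<sigma>\<^sub>B \<delta>\<^sub>B (Suc m) i (act a b) =
      (\<Sum>w | length w = m. (if i = 0 then 0 else act (\<sigma>\<^sub>A (?c w)) (\<sigma>\<^sub>B (?p w (i - 1))))
        + (act (\<sigma>\<^sub>A (?c w)) (\<delta>\<^sub>B (?p w i)) + act (\<delta>\<^sub>A (?c w)) (?p w i)))"
    by (simp add: pi_map_Suc[OF add] Suc.IH additive.sum[OF add(1)] additive.sum[OF add(2)]
        sig del sum.distrib)
  \<comment> \<open>Additivity of \<open>act (\<sigma>\<^sub>A (?c w))\<close> merges the first two
    summands into the term of \<open>True # w\<close>: the extra \<open>True\<close> raises the
    upper index by one, so \<open>pi_map_Suc\<close> applies to it.\<close>
  also have "\<dots> = (\<Sum>w | length w = m. act (?c (True # w)) (?p (True # w) i)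
        + act (?c (False # w)) (?p (False # w) i))"
    by (intro sum.cong) (simp_all add: pi_map_Suc[OF add] additive.add[OF act] additive.zero[OF act] add.assoc)
  also have "\<dots> = (\<Sum>w | length w = Suc m. act (?c w) (?p w i))"
    by (rule sum_lists_length_Suc[symmetric])
  finally show ?case .
qed

text \<open>Removes the case distinction in \<open>pi_op\<close>: for \<open>m < k\<close> the
  operator \<open>z\<close> acts as zero, matching the empty sum.\<close>

lemma act_sum_pi_op:
  assumes "group_with_operators A z act"
  shows "act_sum act (pi_op z \<sigma> \<delta> m k a) x = (\<Sum>w\<in>words m k. act (composite \<sigma> \<delta> w a) x)"
proof (cases "m < k")
  case True
  then show ?thesis
    by (simp add: act_sum_pi_op_eq_0[OF assms] words_eq_empty)
next
  case False
  then show ?thesis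
    by (simp add: act_sum_def pi_op_def sum_unfold_sum_mset image_mset.compositionality comp_def)
qed

theorem proposition24:
  fixes A :: "'a set" and z :: 'a
    and act :: "'a \<Rightarrow> 'b \<Rightarrow> 'b::ab_group_add"
    and \<sigma>\<^sub>A \<delta>\<^sub>A :: "'a \<Rightarrow> 'a"
    and \<sigma>\<^sub>B \<delta>\<^sub>B :: "'b \<Rightarrow> 'b"
    and a :: 'a and b :: 'b and i m :: nat
  assumes "A \<noteq> {}"
    and "group_with_operators A z act"
    and "\<sigma>\<^sub>A \<in> A \<rightarrow> A" and "\<delta>\<^sub>A \<in> A \<rightarrow> A"
    and "additive \<sigma>\<^sub>B" and "additive \<delta>\<^sub>B"
    and "twisted_derivation A act \<sigma>\<^sub>A \<delta>\<^sub>A \<delta>\<^sub>B"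
    and "twisted A act \<sigma>\<^sub>A \<sigma>\<^sub>B"
    and "a \<in> A"
  shows "pi_map \<sigma>\<^sub>B \<delta>\<^sub>B m i (act a b) =
    Sum_any (\<lambda>k. act_sum act (pi_op z \<sigma>\<^sub>A \<delta>\<^sub>A m k a) (pi_map \<sigma>\<^sub>B \<delta>\<^sub>B k i b))"
proof -
  let ?t = "\<lambda>k. act_sum act (pi_op z \<sigma>\<^sub>A \<delta>\<^sub>A m k a) (pi_map \<sigma>\<^sub>B \<delta>\<^sub>B k i b)"
  let ?g = "\<lambda>w. act (composite \<sigma>\<^sub>A \<delta>\<^sub>A w a) (pi_map \<sigma>\<^sub>B \<delta>\<^sub>B (count_list w True) i b)"
  \<comment> \<open>Terms with \<open>k > m\<close> vanish, so the support lies in a finite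
    set.\<close>
  have "Sum_any ?t = (\<Sum>k\<le>m. ?t k)"
    using act_sum_pi_op_eq_0[OF assms(2)]
    by (intro Sum_any.expand_superset) (auto simp: not_less[symmetric])
  also have "\<dots> = (\<Sum>k\<le>m. \<Sum>w\<in>{w\<in>{w. length w = m}. count_list w True = k}. ?g w)"
    by (intro sum.cong) (auto simp: act_sum_pi_op[OF assms(2)] words_def intro!: sum.cong)
  also have "\<dots> = (\<Sum>w | length w = m. ?g w)"
    \<comment> \<open>The classes \<open>k \<le> m\<close> exhaust the words, as a count never
      exceeds the length.\<close>
    by (rule sum.group) (auto intro: count_le_length)
  also have "\<dots> = pi_map \<sigma>\<^sub>B \<delta>\<^sub>B m i (act a b)"
    using assms(2-) by (intro pi_map_act_eq_sum_words[symmetric])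
  finally show ?thesis by simp
qed

end
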